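(* Let $A$ be a ring of rank $n$. Then $\operatorname{disc}(A) \equiv 0$ or $1 \pmod{4}$.
   Context: Rings are associative with multiplicative identity $1$, not necessarily commutative. For $n \in \mathbb{Z}_{\geq 1}$, a ring of rank $n$ is a ring whose additive group is isomorphic to $\mathbb{Z}^n$. A basis $\beta=(e_1,\dots,e_n)$ of $A$ is an ordered $\mathbb{Z}$-basis of its additive group. For $a\in A$, its matrix $\lambda_\beta(a)=(a_{ij})\in \mathrm{M}_n(\mathbb{Z})$ is defined by $a e_j=\sum_{i=1}^n a_{ij}e_i$. The trace pairing is $t_\beta(a,b)=\operatorname{Tr}(\lambda_\beta(ab))$, the Gram matrix is $B(A,\beta)=(t_\beta(e_i,e_j))_{i,j=1}^n$, and the discriminant is $\operatorname{disc}(A)=\det B(A,\beta)$ (independent of the choice of basis). *)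

theory Defs
  imports
    Jordan_Normal_Form.Determinant
    "HOL-Algebra.Product_Groups"
    "HOL-Algebra.Elementary_Groups"
    "HOL-Number_Theory.Cong"
begin

definition ring_of_rank :: "nat \<Rightarrow> ('a, 'b) ring_scheme \<Rightarrow> bool" where
  "ring_of_rank n A \<longleftrightarrow> ring A \<and> n \<ge> 1 \<and>
     add_monoid A \<cong> product_group {..<n} (\<lambda>_. integer_group)"

definition int_lincomb :: "('a, 'b) ring_scheme \<Rightarrow> 'a list \<Rightarrow> int vec \<Rightarrow> 'a" where
  "int_lincomb A es c = (\<Oplus>\<^bsub>A\<^esub>i\<in>{..<length es}. [c $ i] \<cdot>\<^bsub>A\<^esub> (es ! i))"

(* The ordered basis (e_1, ..., e_n) is the list es of length n, so e_i is es ! (i - 1). *)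
definition is_Z_basis :: "('a, 'b) ring_scheme \<Rightarrow> 'a list \<Rightarrow> bool" where
  "is_Z_basis A es \<longleftrightarrow> set es \<subseteq> carrier A \<and>
     (\<forall>a\<in>carrier A. \<exists>!c. c \<in> carrier_vec (length es) \<and> a = int_lincomb A es c)"

(* Meaningful only when es is a basis of A and a lies in A. *)
definition coords :: "('a, 'b) ring_scheme \<Rightarrow> 'a list \<Rightarrow> 'a \<Rightarrow> int vec" where
  "coords A es a = (THE c. c \<in> carrier_vec (length es) \<and> a = int_lincomb A es c)"

definition left_mult_mat :: "('a, 'b) ring_scheme \<Rightarrow> 'a list \<Rightarrow> 'a \<Rightarrow> int mat" where
  "left_mult_mat A es a =
     mat (length es) (length es) (\<lambda>(i, j). coords A es (a \<otimes>\<^bsub>A\<^esub> (es ! j)) $ i)"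

definition mat_trace :: "'a :: comm_monoid_add mat \<Rightarrow> 'a" where
  "mat_trace M = (\<Sum>i<dim_row M. M $$ (i, i))"

definition trace_pairing :: "('a, 'b) ring_scheme \<Rightarrow> 'a list \<Rightarrow> 'a \<Rightarrow> 'a \<Rightarrow> int" where
  "trace_pairing A es a b = mat_trace (left_mult_mat A es (a \<otimes>\<^bsub>A\<^esub> b))"

definition gram_mat :: "('a, 'b) ring_scheme \<Rightarrow> 'a list \<Rightarrow> int mat" where
  "gram_mat A es =
     mat (length es) (length es) (\<lambda>(i, j). trace_pairing A es (es ! i) (es ! j))"

(* The basis is chosen arbitrarily. Lemma disc_eq_det_gram below shows that every basis
   gives the same value, and ring_of_rank_imp_basis that a basis exists. *)
definition disc :: "('a, 'b) ring_scheme \<Rightarrow> int" where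
  "disc A = det (gram_mat A (SOME es. is_Z_basis A es))"

lemma mat_trace_comm:
  fixes M N :: "'a :: comm_semiring_0 mat"
  assumes "M \<in> carrier_mat m n" "N \<in> carrier_mat n m"
  shows "mat_trace (M * N) = mat_trace (N * M)"
proof -
  have "mat_trace (M * N) = (\<Sum>i<m. \<Sum>j<n. M $$ (i, j) * N $$ (j, i))"
    using assms unfolding mat_trace_def
    by (auto simp: scalar_prod_def lessThan_atLeast0 intro!: sum.cong)
  also have "\<dots> = (\<Sum>j<n. \<Sum>i<m. N $$ (j, i) * M $$ (i, j))"
    by (subst sum.swap) (simp add: mult.commute)
  also have "\<dots> = mat_trace (N * M)"
    using assms unfolding mat_trace_def
    by (auto simp: scalar_prod_def lessThan_atLeast0 intro!: sum.cong)
  finally show ?thesis .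
qed

context ring
begin

lemma int_lincomb_closed:
  "set es \<subseteq> carrier R \<Longrightarrow> int_lincomb R es c \<in> carrier R"
  unfolding int_lincomb_def by (intro finsum_closed) (auto simp: subset_iff)

lemma int_lincomb_add:
  assumes "set es \<subseteq> carrier R" "c \<in> carrier_vec (length es)" "d \<in> carrier_vec (length es)"
  shows "int_lincomb R es (c + d) = int_lincomb R es c \<oplus> int_lincomb R es d"
proof -
  have es: "es ! i \<in> carrier R" if "i < length es" for i
    using assms(1) that by (auto simp: subset_iff)
  have "int_lincomb R es (c + d) =
      (\<Oplus>i\<in>{..<length es}. [c $ i] \<cdot> (es ! i) \<oplus> [d $ i] \<cdot> (es ! i))"
    unfolding int_lincomb_def using assms es
    by (intro finsum_cong') (auto simp: add.int_pow_mult)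
  also have "\<dots> = int_lincomb R es c \<oplus> int_lincomb R es d"
    unfolding int_lincomb_def using es by (intro finsum_addf) auto
  finally show ?thesis .
qed

lemma basis_coords:
  assumes "is_Z_basis R es" "a \<in> carrier R"
  shows "coords R es a \<in> carrier_vec (length es)" "int_lincomb R es (coords R es a) = a"
  using theI'[of "\<lambda>c. c \<in> carrier_vec (length es) \<and> a = int_lincomb R es c"] assms
  unfolding is_Z_basis_def coords_def by auto

lemma basis_coords_eqI:
  assumes "is_Z_basis R es" "c \<in> carrier_vec (length es)"
  shows "coords R es (int_lincomb R es c) = c"
  using assms int_lincomb_closed[of es c] unfolding is_Z_basis_def coords_def
  by (intro the1_equality) auto

lemma basis_coords_add:
  assumes "is_Z_basis R es" "a \<in> carrier R" "b \<in> carrier R"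
  shows "coords R es (a \<oplus> b) = coords R es a + coords R es b"
proof -
  have "a \<oplus> b = int_lincomb R es (coords R es a + coords R es b)"
    using assms basis_coords[of es]
    by (subst int_lincomb_add) (auto simp: is_Z_basis_def)
  then show ?thesis
    using assms basis_coords(1)[of es] by (simp add: basis_coords_eqI)
qed

lemma additive_add_pow:
  fixes f :: "'a \<Rightarrow> int"
  assumes f: "\<And>x y. x \<in> carrier R \<Longrightarrow> y \<in> carrier R \<Longrightarrow> f (x \<oplus> y) = f x + f y"
    and a: "a \<in> carrier R"
  shows "f ([(k :: int)] \<cdot> a) = k * f a"
proof -
  have "group_hom (add_monoid R) integer_group f"
    using f by (auto simp: group_hom_def group_hom_axioms_def hom_def add.is_group)
  from group_hom.hom_int_pow[OF this, of a k] a show ?thesis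
    by (simp add: add_pow_def mult.commute)
qed

lemma additive_int_lincomb:
  fixes f :: "'a \<Rightarrow> int"
  assumes f: "\<And>x y. x \<in> carrier R \<Longrightarrow> y \<in> carrier R \<Longrightarrow> f (x \<oplus> y) = f x + f y"
    and es: "set es \<subseteq> carrier R"
  shows "f (int_lincomb R es c) = (\<Sum>i<length es. c $ i * f (es ! i))"
proof -
  have f0: "f \<zero> = 0"
    using f[of \<zero> \<zero>] by simp
  have es': "es ! i \<in> carrier R" if "i < length es" for i
    using es that by (auto simp: subset_iff)
  have "f (\<Oplus>i\<in>I. [c $ i] \<cdot> (es ! i)) = (\<Sum>i\<in>I. c $ i * f (es ! i))"
    if "finite I" "I \<subseteq> {..<length es}" for I
    using that
  proof (induction I rule: finite_induct)
    case empty
    then show ?case by (simp add: f0)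
  next
    case (insert i I)
    then have c: "(\<lambda>i. [c $ i] \<cdot> (es ! i)) \<in> I \<rightarrow> carrier R" "[c $ i] \<cdot> (es ! i) \<in> carrier R"
      using es' by auto
    have "f (\<Oplus>i\<in>insert i I. [c $ i] \<cdot> (es ! i)) =
        f ([c $ i] \<cdot> (es ! i)) + f (\<Oplus>i\<in>I. [c $ i] \<cdot> (es ! i))"
      using insert c by (simp add: finsum_insert f finsum_closed)
    then show ?case
      using insert es' additive_add_pow[of f, OF f] by auto
  qed
  then show ?thesis
    unfolding int_lincomb_def by simp
qed

definition base_change :: "'a list \<Rightarrow> 'a list \<Rightarrow> int mat" where
  "base_change es bs = mat (length es) (length bs) (\<lambda>(i, j). coords R es (bs ! j) $ i)"

lemma additive_basis:
  fixes f :: "'a \<Rightarrow> int"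
  assumes f: "\<And>x y. x \<in> carrier R \<Longrightarrow> y \<in> carrier R \<Longrightarrow> f (x \<oplus> y) = f x + f y"
    and es: "is_Z_basis R es" and a: "a \<in> carrier R"
  shows "f a = (\<Sum>i<length es. coords R es a $ i * f (es ! i))"
  using additive_int_lincomb[of f es "coords R es a", OF f] basis_coords(2)[OF es a] es
  by (simp add: is_Z_basis_def)

lemma basis_nth: "is_Z_basis R es \<Longrightarrow> i < length es \<Longrightarrow> es ! i \<in> carrier R"
  by (auto simp: is_Z_basis_def subset_iff)

lemma coords_index_add:
  assumes "is_Z_basis R es" "i < length es" "a \<in> carrier R" "b \<in> carrier R"
  shows "coords R es (a \<oplus> b) $ i = coords R es a $ i + coords R es b $ i"
  using assms basis_coords(1)[of es b] by (simp add: basis_coords_add)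

lemma coords_basis_nth:
  assumes "is_Z_basis R es" "i < length es" "j < length es"
  shows "coords R es (es ! j) $ i = (if i = j then 1 else 0)"
proof -
  have zero: "[(0 :: int)] \<cdot> x = \<zero>" for x
    by (simp add: add_pow_def)
  have "int_lincomb R es (unit_vec (length es) j) =
      (\<Oplus>i\<in>{..<length es}. if j = i then es ! i else \<zero>)"
    unfolding int_lincomb_def using assms basis_nth[of es]
    by (intro finsum_cong') (auto simp: zero)
  also have "\<dots> = es ! j"
    using assms basis_nth[of es] by (intro finsum_singleton) auto
  finally have "coords R es (es ! j) = unit_vec (length es) j"
    using basis_coords_eqI[OF assms(1), of "unit_vec (length es) j"] by simp
  then show ?thesis
    using assms by simp
qed

lemma base_change_inverse:
  assumes es: "is_Z_basis R es" and bs: "is_Z_basis R bs"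
  shows "base_change es bs * base_change bs es = 1\<^sub>m (length es)"
proof (rule eq_matI)
  fix i j assume "i < dim_row (1\<^sub>m (length es))" "j < dim_col (1\<^sub>m (length es))"
  then have ij: "i < length es" "j < length es" by auto
  have "(base_change es bs * base_change bs es) $$ (i, j) =
      (\<Sum>k<length bs. coords R bs (es ! j) $ k * coords R es (bs ! k) $ i)"
    using ij by (auto simp: base_change_def scalar_prod_def lessThan_atLeast0 mult.commute
        intro!: sum.cong)
  also have "\<dots> = coords R es (es ! j) $ i"
    using ij by (intro additive_basis[of "\<lambda>a. coords R es a $ i", symmetric]
        coords_index_add es bs basis_nth)
  finally show "(base_change es bs * base_change bs es) $$ (i, j) = 1\<^sub>m (length es) $$ (i, j)"
    using ij es by (simp add: coords_basis_nth)
qed (auto simp: base_change_def)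

lemma base_change_carrier: "base_change es bs \<in> carrier_mat (length es) (length bs)"
  by (simp add: base_change_def)

lemma left_mult_mat_carrier: "left_mult_mat R es a \<in> carrier_mat (length es) (length es)"
  by (simp add: left_mult_mat_def)

lemma basis_length_eq:
  assumes es: "is_Z_basis R es" and bs: "is_Z_basis R bs"
  shows "length es = length bs"
proof -
  have tr: "mat_trace (1\<^sub>m n :: int mat) = int n" for n
    by (simp add: mat_trace_def)
  show ?thesis
    using mat_trace_comm[OF base_change_carrier base_change_carrier, of es bs]
    by (simp add: base_change_inverse es bs tr)
qed

lemma left_mult_mat_base_change:
  assumes es: "is_Z_basis R es" and bs: "is_Z_basis R bs" and a: "a \<in> carrier R"
  shows "base_change es bs * left_mult_mat R bs a = left_mult_mat R es a * base_change es bs"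
proof (rule eq_matI)
  fix i j
  assume "i < dim_row (left_mult_mat R es a * base_change es bs)"
    and "j < dim_col (left_mult_mat R es a * base_change es bs)"
  then have ij: "i < length es" "j < length bs"
    by (auto simp: left_mult_mat_def base_change_def)
  have "(base_change es bs * left_mult_mat R bs a) $$ (i, j) =
      (\<Sum>k<length bs. coords R bs (a \<otimes> (bs ! j)) $ k * coords R es (bs ! k) $ i)"
    using ij by (auto simp: base_change_def left_mult_mat_def scalar_prod_def
        lessThan_atLeast0 mult.commute intro!: sum.cong)
  also have "\<dots> = coords R es (a \<otimes> (bs ! j)) $ i"
    using ij a by (intro additive_basis[of "\<lambda>a. coords R es a $ i", symmetric]
        coords_index_add es bs m_closed basis_nth)
  also have "\<dots> = (\<Sum>k<length es. coords R es (bs ! j) $ k * coords R es (a \<otimes> (es ! k)) $ i)"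
    using ij a es
    by (intro additive_basis[of "\<lambda>x. coords R es (a \<otimes> x) $ i"] es basis_nth[OF bs])
      (auto simp: r_distr coords_index_add)
  also have "\<dots> = (left_mult_mat R es a * base_change es bs) $$ (i, j)"
    using ij by (auto simp: base_change_def left_mult_mat_def scalar_prod_def
        lessThan_atLeast0 mult.commute intro!: sum.cong)
  finally show "(base_change es bs * left_mult_mat R bs a) $$ (i, j) =
      (left_mult_mat R es a * base_change es bs) $$ (i, j)" .
qed (auto simp: base_change_def left_mult_mat_def)

lemma trace_pairing_basis_independent:
  assumes es: "is_Z_basis R es" and bs: "is_Z_basis R bs"
    and ab: "a \<in> carrier R" "b \<in> carrier R"
  shows "trace_pairing R bs a b = trace_pairing R es a b"
proof -
  let ?n = "length es" and ?P = "base_change es bs" and ?Q = "base_change bs es"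
  let ?L = "left_mult_mat R es (a \<otimes> b)" and ?M = "left_mult_mat R bs (a \<otimes> b)"
  have len: "length bs = ?n"
    using basis_length_eq[OF bs es] .
  have c: "?P \<in> carrier_mat ?n ?n" "?Q \<in> carrier_mat ?n ?n"
    "?L \<in> carrier_mat ?n ?n" "?M \<in> carrier_mat ?n ?n"
    using base_change_carrier[of es bs] base_change_carrier[of bs es]
      left_mult_mat_carrier[of es "a \<otimes> b"] left_mult_mat_carrier[of bs "a \<otimes> b"] len by auto
  have PQ: "?P * ?Q = 1\<^sub>m ?n" and QP: "?Q * ?P = 1\<^sub>m ?n"
    using base_change_inverse[OF es bs] base_change_inverse[OF bs es] len by auto
  have "?M = (?Q * ?P) * ?M"
    using c QP by simp
  also have "\<dots> = ?Q * (?P * ?M)"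
    using c by (intro assoc_mult_mat)
  also have "?P * ?M = ?L * ?P"
    using left_mult_mat_base_change[OF es bs] ab by simp
  finally have "mat_trace ?M = mat_trace (?Q * (?L * ?P))" by simp
  also have "\<dots> = mat_trace ((?L * ?P) * ?Q)"
    using c by (intro mat_trace_comm) auto
  also have "(?L * ?P) * ?Q = ?L * (?P * ?Q)"
    using c by (intro assoc_mult_mat)
  also have "\<dots> = ?L"
    using c PQ by simp
  finally show ?thesis
    by (simp add: trace_pairing_def)
qed

lemma trace_additive:
  assumes es: "is_Z_basis R es" and xy: "x \<in> carrier R" "y \<in> carrier R"
  shows "mat_trace (left_mult_mat R es (x \<oplus> y)) =
    mat_trace (left_mult_mat R es x) + mat_trace (left_mult_mat R es y)"
  using es xy basis_nth[OF es]
  by (auto simp: mat_trace_def left_mult_mat_def l_distr coords_index_add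
      simp flip: sum.distrib intro!: sum.cong)

lemma gram_mat_base_change:
  assumes es: "is_Z_basis R es" and bs: "is_Z_basis R bs"
  shows "gram_mat R bs =
    transpose_mat (base_change es bs) * (gram_mat R es * base_change es bs)"
proof (rule eq_matI)
  fix i j
  assume "i < dim_row (transpose_mat (base_change es bs) * (gram_mat R es * base_change es bs))"
    and "j < dim_col (transpose_mat (base_change es bs) * (gram_mat R es * base_change es bs))"
  then have ij: "i < length bs" "j < length bs"
    by (auto simp: base_change_def)
  let ?t = "trace_pairing R es"
  have "gram_mat R bs $$ (i, j) = ?t (bs ! i) (bs ! j)"
    using ij by (simp add: gram_mat_def trace_pairing_basis_independent[OF es bs] basis_nth[OF bs])
  also have "\<dots> = (\<Sum>k<length es. coords R es (bs ! i) $ k * ?t (es ! k) (bs ! j))"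
    using ij es bs by (intro additive_basis[of "\<lambda>x. ?t x (bs ! j)"])
      (auto simp: trace_pairing_def l_distr trace_additive basis_nth)
  also have "\<dots> = (\<Sum>k<length es. coords R es (bs ! i) $ k *
      (\<Sum>l<length es. coords R es (bs ! j) $ l * ?t (es ! k) (es ! l)))"
  proof (intro sum.cong refl arg_cong2[where f = "(*)"])
    fix k assume "k \<in> {..<length es}"
    then show "?t (es ! k) (bs ! j) =
        (\<Sum>l<length es. coords R es (bs ! j) $ l * ?t (es ! k) (es ! l))"
      using ij es bs by (intro additive_basis[of "?t (es ! k)"])
        (auto simp: trace_pairing_def r_distr trace_additive basis_nth)
  qed
  also have "\<dots> = (transpose_mat (base_change es bs) * (gram_mat R es * base_change es bs)) $$ (i, j)"
    using ij by (auto simp: base_change_def gram_mat_def scalar_prod_def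
        lessThan_atLeast0 mult.commute intro!: sum.cong)
  finally show "gram_mat R bs $$ (i, j) =
      (transpose_mat (base_change es bs) * (gram_mat R es * base_change es bs)) $$ (i, j)" .
qed (auto simp: base_change_def gram_mat_def)

lemma det_gram_basis_independent:
  assumes es: "is_Z_basis R es" and bs: "is_Z_basis R bs"
  shows "det (gram_mat R bs) = det (gram_mat R es)"
proof -
  let ?n = "length es" and ?P = "base_change es bs" and ?Q = "base_change bs es"
  let ?G = "gram_mat R es"
  have len: "length bs = ?n"
    using basis_length_eq[OF bs es] .
  have c: "?P \<in> carrier_mat ?n ?n" "?Q \<in> carrier_mat ?n ?n" "?G \<in> carrier_mat ?n ?n"
    using base_change_carrier[of es bs] base_change_carrier[of bs es] len
    by (auto simp: gram_mat_def)
  have "det ?P * det ?Q = 1"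
    using det_mult[OF c(1,2)] base_change_inverse[OF es bs] by simp
  then have sq: "det ?P * det ?P = 1"
    by (auto simp: zmult_eq_1_iff)
  have "det (gram_mat R bs) = det ?P * (det ?G * det ?P)"
    using c by (simp add: gram_mat_base_change[OF es bs] det_mult[of _ ?n] det_transpose)
  also have "\<dots> = det ?G"
    using sq by (metis mult.commute mult.left_commute mult.right_neutral)
  finally show ?thesis .
qed

end

lemma disc_eq_det_gram:
  assumes "ring A" "is_Z_basis A es"
  shows "disc A = det (gram_mat A es)"
  unfolding disc_def using assms
  by (intro ring.det_gram_basis_independent someI[of "is_Z_basis A"])

lemma ring_of_rank_imp_basis:
  assumes "ring_of_rank n A"
  shows "\<exists>es. is_Z_basis A es \<and> length es = n"
proof -
  interpret A: ring A
    using assms by (simp add: ring_of_rank_def)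
  let ?Z = "product_group {..<n} (\<lambda>_. integer_group)"
  have Z: "group ?Z" by simp
  obtain h where h: "h \<in> iso (add_monoid A) ?Z"
    using assms by (auto simp: ring_of_rank_def is_iso_def)
  have bij: "bij_betw h (carrier A) (carrier ?Z)"
    using h by (auto simp: iso_def)
  have h_add: "h (x \<oplus>\<^bsub>A\<^esub> y) i = h x i + h y i"
    if "x \<in> carrier A" "y \<in> carrier A" "i < n" for x y i
    using h that by (simp add: iso_def hom_def)
  define u where "u j = (\<lambda>i\<in>{..<n}. if i = j then 1 else 0 :: int)" for j
  define es where "es = map (\<lambda>j. inv_into (carrier A) h (u j)) [0..<n]"
  have u: "u j \<in> carrier ?Z" for j
    by (auto simp: u_def)
  have len: "length es = n"
    by (simp add: es_def)
  have es: "set es \<subseteq> carrier A"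
    using bij u by (auto simp: es_def bij_betw_def intro!: inv_into_into)
  have h_es: "h (es ! j) = u j" if "j < n" for j
    using bij u that by (auto simp: es_def bij_betw_def intro!: f_inv_into_f)
  have h_comb: "h (int_lincomb A es c) i = c $ i" if "i < n" for c i
  proof -
    have "h (int_lincomb A es c) i = (\<Sum>j<length es. c $ j * h (es ! j) i)"
      using that by (intro A.additive_int_lincomb[of "\<lambda>x. h x i"] es h_add)
    also have "\<dots> = (\<Sum>j<n. if i = j then c $ j else 0)"
      unfolding len using that by (intro sum.cong) (auto simp: h_es u_def)
    also have "\<dots> = c $ i"
      using that by simp
    finally show ?thesis .
  qed
  have h_inj: "x = y" if "x \<in> carrier A" "y \<in> carrier A" "\<And>i. i < n \<Longrightarrow> h x i = h y i" for x y
  proof -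
    have "h x \<in> carrier ?Z" "h y \<in> carrier ?Z"
      using bij that by (auto simp: bij_betw_def)
    then have "h x = h y"
      using that(3) by (intro PiE_ext[where k = "{..<n}"]) auto
    then show ?thesis
      using bij that by (auto simp: bij_betw_def inj_on_def)
  qed
  have "\<exists>!c. c \<in> carrier_vec (length es) \<and> a = int_lincomb A es c" if a: "a \<in> carrier A" for a
  proof (rule ex1I[of _ "vec n (h a)"])
    show "vec n (h a) \<in> carrier_vec (length es) \<and> a = int_lincomb A es (vec n (h a))"
      using a es by (auto simp: len h_comb intro!: h_inj A.int_lincomb_closed)
  next
    fix c assume "c \<in> carrier_vec (length es) \<and> a = int_lincomb A es c"
    then show "c = vec n (h a)"
      by (intro eq_vecI) (auto simp: len h_comb)
  qed
  then show ?thesis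
    using es len unfolding is_Z_basis_def by blast
qed

end

theory Submission
  imports Defs
begin

text \<open>Since \<open>Tr (M\<^sup>2) \<equiv> Tr M\<close> modulo 2 for an integer matrix \<open>M\<close>, the trace form satisfies
  \<open>t(x, x) \<equiv> t(x, 1)\<close> modulo 2: the element 1 is a characteristic vector, and
  \<open>t(1, 1) = n\<close>. Let \<open>B\<close> be the Gram matrix and \<open>u\<close> the covector \<open>t(_, 1)\<close>. For even \<open>n\<close> the
  matrix \<open>B + u u\<^sup>T\<close>, of determinant \<open>det B * (n + 1)\<close>, is symmetric with even diagonal;
  for odd \<open>n\<close> the same holds after adjoining the orthogonal summand \<open>\<langle>1\<rangle>\<close>, with determinant
  \<open>det B * (n + 2)\<close>. A symmetric matrix of size \<open>2 * k\<close> with even diagonal has determinant 0 or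
  \<open>(-1)\<^sup>k\<close> modulo 4, by splitting off invertible blocks of size two.\<close>

section \<open>Even symmetric integer matrices and their determinants modulo 4\<close>

lemma det_cong:
  fixes M N :: "int mat"
  assumes M: "M \<in> carrier_mat n n" and N: "N \<in> carrier_mat n n"
    and MN: "\<And>i j. i < n \<Longrightarrow> j < n \<Longrightarrow> [M $$ (i, j) = N $$ (i, j)] (mod m)"
  shows "[det M = det N] (mod m)"
  unfolding det_def'[OF M] det_def'[OF N]
  by (intro cong_sum cong_mult cong_refl cong_prod MN) (auto dest: permutes_in_image)

text \<open>Permuting rows and columns simultaneously contributes the sign of the permutation
  twice.\<close>

lemma det_reindex:
  fixes M :: "int mat"
  assumes M: "M \<in> carrier_mat n n" and p: "p permutes {0..<n}"
  shows "det (mat n n (\<lambda>(i, j). M $$ (p i, p j))) = det M"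
proof -
  have lt: "p i < n" if "i < n" for i
    using permutes_in_image[OF p, of i] that by simp
  define N where "N = mat n n (\<lambda>(i, j). M $$ (p i, j))"
  have N: "N \<in> carrier_mat n n" by (simp add: N_def)
  have "mat n n (\<lambda>(i, j). M $$ (p i, p j)) =
      transpose_mat (mat n n (\<lambda>(i, j). transpose_mat N $$ (p i, j)))"
    using lt by (intro eq_matI) (auto simp: N_def)
  also have "det \<dots> = signof p * det (transpose_mat N)"
    using N p by (simp add: det_transpose[where n = n] det_permute_rows)
  also have "\<dots> = signof p * (signof p * det M)"
    using det_permute_rows[OF M p] by (simp add: det_transpose[OF N, unfolded N_def] N_def)
  also have "\<dots> = det M"
    by (simp add: sign_def)
  finally show ?thesis .
qed

lemma det_2x2:
  fixes M :: "'a :: comm_ring_1 mat"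
  assumes "M \<in> carrier_mat 2 2"
  shows "det M = M $$ (0, 0) * M $$ (1, 1) - M $$ (0, 1) * M $$ (1, 0)"
  using assms
  by (simp add: laplace_expansion_row[OF assms, of 0] numeral_2_eq_2 cofactor_def
      det_single[OF carrier_matI] mat_delete_def)

text \<open>These are the Gram matrices of even integral bilinear forms, possibly
  degenerate.\<close>

definition even_symmetric :: "nat \<Rightarrow> int mat \<Rightarrow> bool" where
  "even_symmetric n S \<longleftrightarrow> S \<in> carrier_mat n n \<and>
     (\<forall>i<n. \<forall>j<n. S $$ (i, j) = S $$ (j, i)) \<and> (\<forall>i<n. even (S $$ (i, i)))"

text \<open>An invertible even symmetric block of size two has determinant \<open>- 1\<close> modulo 4,
  so modulo 4 its adjugate is minus its inverse and the Schur complement needs no division.\<close>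

lemma even_symmetric_schur:
  assumes S: "even_symmetric (2 + m) S" and odd: "odd (S $$ (0, 1))"
  obtains T where "even_symmetric m T" "[det S = - det T] (mod 4)"
proof -
  have dim: "S \<in> carrier_mat (2 + m) (2 + m)"
    and sym: "\<And>i j. i < 2 + m \<Longrightarrow> j < 2 + m \<Longrightarrow> S $$ (i, j) = S $$ (j, i)"
    and even: "\<And>i. i < 2 + m \<Longrightarrow> even (S $$ (i, i))"
    using S by (auto simp: even_symmetric_def)
  define a b c where "a = S $$ (0, 0)" and "b = S $$ (1, 1)" and "c = S $$ (0, 1)"
  have S10: "S $$ (Suc 0, 0) = c"
    using sym[of 1 0] by (simp add: c_def)
  define d where "d = a * b - c * c"
  have d: "4 dvd d + 1"
  proof -
    obtain a' b' c' where "a = 2 * a'" "b = 2 * b'" "c = 2 * c' + 1"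
      using even[of 0] even[of 1] odd unfolding a_def b_def c_def by (auto elim!: evenE oddE)
    then have "d + 1 = 4 * (a' * b' - c' * c' - c')"
      by (simp add: d_def algebra_simps)
    then show ?thesis by simp
  qed
  define q r where "q j = S $$ (0, j + 2)" and "r j = S $$ (1, j + 2)" for j
  define P where "P = mat 2 2 (\<lambda>ij. S $$ ij)"
  define Q where "Q = mat 2 m (\<lambda>(i, j). S $$ (i, j + 2))"
  define Q' where "Q' = mat m 2 (\<lambda>(i, j). S $$ (i + 2, j))"
  define R where "R = mat m m (\<lambda>(i, j). S $$ (i + 2, j + 2))"
  \<comment> \<open>\<open>Y\<close> is adj(P) Q, where adj(P) has rows (b, -c) and (-c, a). Hence
    \<open>P * Y + Q\<close> equals (d + 1) Q, which vanishes modulo 4.\<close>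
  define Y where
    "Y = mat 2 m (\<lambda>(i, j). if i = 0 then b * q j - c * r j else a * r j - c * q j)"
  \<comment> \<open>This is R + Q^T adj(P) Q: the Schur complement R - Q^T P^(-1) Q with P^(-1)
    replaced by -adj(P).\<close>
  define T where "T = mat m m (\<lambda>(i, j). R $$ (i, j) +
    (b * (q i * q j) - c * (q i * r j + r i * q j) + a * (r i * r j)))"
  have c: "P \<in> carrier_mat 2 2" "Q \<in> carrier_mat 2 m" "Q' \<in> carrier_mat m 2"
    "R \<in> carrier_mat m m" "Y \<in> carrier_mat 2 m" "T \<in> carrier_mat m m"
    by (simp_all add: P_def Q_def Q'_def R_def Y_def T_def)
  have S_block: "S = four_block_mat P Q Q' R"
  proof -
    have "Suc (Suc (i - 2)) = i" if "\<not> i < 2" for i using that by simp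
    then show ?thesis
      using dim by (intro eq_matI) (auto simp: P_def Q_def Q'_def R_def)
  qed
  let ?X = "four_block_mat (1\<^sub>m 2) Y (0\<^sub>m m 2) (1\<^sub>m m)"
  let ?Z = "four_block_mat P (0\<^sub>m 2 m) Q' T"
  have X: "?X \<in> carrier_mat (2 + m) (2 + m)"
    using c by (intro four_block_carrier_mat) auto
  have X_det: "det ?X = 1"
    using c by (subst det_four_block_mat_lower_left_zero[of _ 2 _ m]) auto
  have PY: "P * Y + Q = mat 2 m (\<lambda>(i, j). (d + 1) * Q $$ (i, j))"
    by (rule eq_matI) (auto simp: P_def Q_def Y_def scalar_prod_def d_def a_def[symmetric]
        b_def[symmetric, unfolded One_nat_def] c_def[symmetric, unfolded One_nat_def]
        numeral_2_eq_2 q_def r_def S10 less_Suc_eq algebra_simps)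
  have QY: "Q' * Y + R = T"
  proof (rule eq_matI)
    fix i j assume "i < dim_row T" "j < dim_col T"
    then have ij: "i < m" "j < m" by (auto simp: T_def)
    have "S $$ (i + 2, 0) = q i" "S $$ (i + 2, Suc 0) = r i"
      using ij sym[of "i + 2"] by (auto simp: q_def r_def)
    then show "(Q' * Y + R) $$ (i, j) = T $$ (i, j)"
      using ij c by (auto simp: T_def Q'_def Y_def scalar_prod_def numeral_2_eq_2 algebra_simps)
  qed (use c in auto)
  have "S * ?X = four_block_mat P (P * Y + Q) Q' (Q' * Y + R)"
    unfolding S_block using c by (subst mult_four_block_mat[of _ 2 2 _ m _ m _ _ 2 _ m]) auto
  then have SX: "S * ?X = four_block_mat P (P * Y + Q) Q' T"
    by (simp only: QY)
  have "det S = det (S * ?X)"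
    using det_mult[OF dim X] X_det by simp
  also have "[det (S * ?X) = det ?Z] (mod 4)"
  proof (rule det_cong[of _ "2 + m"])
    show "S * ?X \<in> carrier_mat (2 + m) (2 + m)" "?Z \<in> carrier_mat (2 + m) (2 + m)"
      using dim X c by auto
    show "[(S * ?X) $$ (i, j) = ?Z $$ (i, j)] (mod 4)" if "i < 2 + m" "j < 2 + m" for i j
      unfolding SX PY using that c d by (auto simp: cong_0_iff dest: dvd_mult2)
  qed
  also have "det ?Z = det P * det T"
    using c by (intro det_four_block_mat_upper_right_zero) auto
  also have "det P = d"
    using det_2x2[OF c(1)] by (simp add: P_def d_def a_def b_def c_def S10)
  also have "[d * det T = (- 1) * det T] (mod 4)"
    using d by (intro cong_mult) (auto simp: cong_iff_dvd_diff)
  finally have "[det S = - det T] (mod 4)" by simp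
  \<comment> \<open>On the diagonal the two cross terms with coefficient \<open>c\<close> coincide,
    and the square terms carry the even factors \<open>a\<close> and \<open>b\<close>.\<close>
  moreover have "even_symmetric m T"
    using even[of 0] even[of 1] even sym c
    by (auto simp: even_symmetric_def T_def R_def a_def b_def algebra_simps)
  ultimately show ?thesis using that by blast
qed

lemma even_symmetric_reindex:
  assumes S: "even_symmetric n S" and p: "p permutes {0..<n}"
  shows "even_symmetric n (mat n n (\<lambda>(i, j). S $$ (p i, p j)))"
  using S permutes_in_image[OF p] by (auto simp: even_symmetric_def)

text \<open>Each step of the induction moves an odd entry, if there is one, to position (0, 1) and
  splits off its block, which costs a factor -1. The empty matrix has determinant 1.\<close>

lemma det_even_symmetric:
  assumes "even_symmetric (2 * k) S"
  shows "[det S = 0] (mod 4) \<or> [det S = (- 1) ^ k] (mod 4)"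
  using assms
proof (induction k arbitrary: S)
  case 0
  then show ?case by (simp add: even_symmetric_def)
next
  case (Suc k)
  let ?n = "2 + 2 * k"
  have S: "even_symmetric ?n S" using Suc.prems by simp
  then have dim: "S \<in> carrier_mat ?n ?n" by (simp add: even_symmetric_def)
  show ?case
  proof (cases "\<exists>i<?n. \<exists>j<?n. odd (S $$ (i, j))")
    case True
    then obtain i j where ij: "i < ?n" "j < ?n" "odd (S $$ (i, j))" by blast
    with S have "i \<noteq> j" by (auto simp: even_symmetric_def)
    \<comment> \<open>The inner swap sends 1 to the preimage of \<open>j\<close> under the outer
      swap and fixes 0, because \<open>i \<noteq> j\<close>.\<close>
    define p where "p = transpose 0 i \<circ> transpose 1 (transpose 0 i j)"
    have p: "p permutes {0..<?n}"
      unfolding p_def using ij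
      by (intro permutes_compose permutes_swap_id) (auto simp: transpose_def)
    have p01: "p 0 = i" "p 1 = j"
      using \<open>i \<noteq> j\<close> by (auto simp: p_def transpose_def)
    define S' where "S' = mat ?n ?n (\<lambda>(i, j). S $$ (p i, p j))"
    have "even_symmetric ?n S'" "odd (S' $$ (0, 1))"
      using even_symmetric_reindex[OF S p] ij p01 by (auto simp: S'_def)
    then obtain T where T: "even_symmetric (2 * k) T" "[det S' = - det T] (mod 4)"
      using even_symmetric_schur by metis
    have "det S' = det S"
      unfolding S'_def by (rule det_reindex[OF dim p])
    moreover have "[- det T = 0] (mod 4) \<or> [- det T = - ((- 1) ^ k)] (mod 4)"
      using Suc.IH[OF T(1)] by (simp add: cong_0_iff cong_minus_minus_iff)
    ultimately show ?thesis
      using T(2) by (auto dest: cong_trans)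
  next
    case False
    \<comment> \<open>With all entries even, a factor 2 comes out of each of the at least two
      rows.\<close>
    define T where "T = mat ?n ?n (\<lambda>ij. S $$ ij div 2)"
    have "S = 2 \<cdot>\<^sub>m T"
      using False dim by (intro eq_matI) (auto simp: T_def)
    moreover have "dim_col T = ?n"
      by (simp add: T_def)
    ultimately have "det S = 2 ^ ?n * det T"
      by (metis det_smult)
    then show ?thesis
      by (simp add: cong_0_iff power_add)
  qed
qed

section \<open>Rank-one updates and characteristic vectors\<close>

text \<open>Subtracting \<open>B * W\<close> times the last row from the upper rows leaves B and
  \<open>- (B * W)\<close> on top; adding the first n columns times \<open>W\<close> to the last
  column then clears the upper right block. The value c = 1 gives the matrix determinant lemma for
  \<open>B + B * W * V\<close>; c = 2 serves the case of odd n.\<close>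

lemma det_bordered:
  fixes B :: "int mat"
  assumes B: "B \<in> carrier_mat n n" and W: "W \<in> carrier_mat n 1" and V: "V \<in> carrier_mat 1 n"
  shows "det (four_block_mat (B + B * W * V) ((c - 1) \<cdot>\<^sub>m (B * W)) V (c \<cdot>\<^sub>m 1\<^sub>m 1)) =
    det B * (c + (V * W) $$ (0, 0))"
proof -
  define U where "U = B * W"
  have U: "U \<in> carrier_mat n 1" using B W by (simp add: U_def)
  note cs = B W V U
  define X where "X = four_block_mat (1\<^sub>m n) (- U) (0\<^sub>m 1 n) (1\<^sub>m 1)"
  define Y where "Y = four_block_mat (1\<^sub>m n) W (0\<^sub>m 1 n) (1\<^sub>m 1)"
  define N where "N = four_block_mat (B + U * V) ((c - 1) \<cdot>\<^sub>m U) V (c \<cdot>\<^sub>m 1\<^sub>m 1)"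
  have cX: "X \<in> carrier_mat (n + 1) (n + 1)" "Y \<in> carrier_mat (n + 1) (n + 1)"
    "N \<in> carrier_mat (n + 1) (n + 1)"
    unfolding X_def Y_def N_def using cs by (intro four_block_carrier_mat; simp)+
  have dets: "det X = 1" "det Y = 1"
    unfolding X_def Y_def using cs
    by (simp_all add: det_four_block_mat_lower_left_zero[of _ n _ 1])
  have 1: "1\<^sub>m n * (B + U * V) + - U * V = B"
    using cs by (intro eq_matI) auto
  have 2: "1\<^sub>m n * ((c - 1) \<cdot>\<^sub>m U) + - U * (c \<cdot>\<^sub>m 1\<^sub>m 1) = - U"
    using cs by (intro eq_matI) (auto simp: scalar_prod_def algebra_simps)
  have "X * N = four_block_mat B (- U) V (c \<cdot>\<^sub>m 1\<^sub>m 1)"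
    unfolding X_def N_def using cs 1 2
    by (subst mult_four_block_mat[of _ n n _ 1 _ 1 _ _ n _ 1]) auto
  then have "X * N * Y = four_block_mat B (- U) V (c \<cdot>\<^sub>m 1\<^sub>m 1) * Y"
    by simp
  also have "\<dots> = four_block_mat B (B * W + - U) V (V * W + c \<cdot>\<^sub>m 1\<^sub>m 1)"
    unfolding Y_def using cs by (subst mult_four_block_mat[of _ n n _ 1 _ 1 _ _ n _ 1]) auto
  also have "B * W + - U = 0\<^sub>m n 1"
    using cs by (intro eq_matI) (auto simp: U_def)
  finally have "det (X * N * Y) = det B * det (V * W + c \<cdot>\<^sub>m 1\<^sub>m 1)"
    using cs by (simp add: det_four_block_mat_upper_right_zero[of _ n _ 1])
  also have "det (V * W + c \<cdot>\<^sub>m 1\<^sub>m 1) = c + (V * W) $$ (0, 0)"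
    using cs by (subst det_single) auto
  also have "det (X * N * Y) = det N"
    using cX dets by (simp add: det_mult[of _ "n + 1"])
  finally show ?thesis
    by (simp add: N_def U_def)
qed

text \<open>Modulo 4 the factor \<open>1 + 2 * int k\<close> is \<open>(- 1) ^ k\<close>, which is
  its own inverse.\<close>

lemma cong_cancel_sign:
  fixes x :: int
  assumes "[x * (1 + 2 * int k) = 0] (mod 4) \<or> [x * (1 + 2 * int k) = (- 1) ^ k] (mod 4)"
  shows "[x = 0] (mod 4) \<or> [x = 1] (mod 4)"
proof -
  have "4 dvd 1 + 2 * int k - (- 1) ^ k"
    by (cases "even k") (auto elim!: evenE oddE)
  then have "[x * (- 1) ^ k * (1 + 2 * int k) = x * (- 1) ^ k * (- 1) ^ k] (mod 4)"
    by (intro cong_mult cong_refl) (simp add: cong_iff_dvd_diff)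
  moreover have sq: "(- 1 :: int) ^ k * (- 1) ^ k = 1"
    by (simp flip: power_add)
  ultimately have x: "[x * (1 + 2 * int k) * (- 1) ^ k = x] (mod 4)"
    by (simp only: mult.assoc mult.commute[of "1 + 2 * int k"] mult_1_right)
  from assms show ?thesis
  proof
    assume "[x * (1 + 2 * int k) = 0] (mod 4)"
    from cong_scalar_right[OF this, of "(- 1) ^ k"] x show ?thesis
      by (metis cong_sym cong_trans mult_zero_left)
  next
    assume "[x * (1 + 2 * int k) = (- 1) ^ k] (mod 4)"
    from cong_scalar_right[OF this, of "(- 1) ^ k"] x show ?thesis
      unfolding sq by (metis cong_sym cong_trans)
  qed
qed

text \<open>The vector \<open>w\<close> is characteristic for the symmetric bilinear form with matrix \<open>B\<close>, and
  \<open>u\<close> is its dual covector.\<close>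

lemma det_characteristic_vector:
  fixes B :: "int mat" and u w :: "nat \<Rightarrow> int"
  assumes B: "B \<in> carrier_mat n n"
    and sym: "\<And>i j. i < n \<Longrightarrow> j < n \<Longrightarrow> B $$ (i, j) = B $$ (j, i)"
    and char: "\<And>i. i < n \<Longrightarrow> even (B $$ (i, i) - u i)"
    and dual: "\<And>i. i < n \<Longrightarrow> (\<Sum>j<n. B $$ (i, j) * w j) = u i"
    and norm: "(\<Sum>i<n. u i * w i) = int n"
  shows "[det B = 0] (mod 4) \<or> [det B = 1] (mod 4)"
proof -
  define W where "W = mat n 1 (\<lambda>(i, _). w i)"
  define V where "V = mat 1 n (\<lambda>(_, j). u j)"
  define C where "C = B + B * W * V"
  have W: "W \<in> carrier_mat n 1" and V: "V \<in> carrier_mat 1 n"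
    by (simp_all add: W_def V_def)
  then have C: "C \<in> carrier_mat n n"
    using B by (simp add: C_def)
  have BW: "B * W = mat n 1 (\<lambda>(i, _). u i)"
    using B dual by (intro eq_matI) (auto simp: W_def scalar_prod_def lessThan_atLeast0)
  have VW: "(V * W) $$ (0, 0) = int n"
    using norm by (simp add: W_def V_def scalar_prod_def lessThan_atLeast0)
  have C_nth: "C $$ (i, j) = B $$ (i, j) + u i * u j" if "i < n" "j < n" for i j
    using that B unfolding C_def BW by (simp add: V_def scalar_prod_def)
  \<comment> \<open>The diagonal entry B_ii + u_i^2 has the parity of B_ii - u_i.\<close>
  have C_even: "even_symmetric n C"
    using C sym char by (auto simp: even_symmetric_def C_nth)
  define N where "N c = four_block_mat C ((c - 1) \<cdot>\<^sub>m (B * W)) V (c \<cdot>\<^sub>m 1\<^sub>m 1)" for c :: int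
  have N: "det (N c) = det B * (c + int n)" for c
    using det_bordered[OF B W V, of c] by (simp add: N_def C_def VW)
  show ?thesis
  proof (cases "even n")
    case True
    then obtain k where n: "n = 2 * k" by (elim evenE)
    \<comment> \<open>At c = 1 the upper right block vanishes, so
      \<open>det (N 1) = det C\<close>.\<close>
    have "N 1 = four_block_mat C (0\<^sub>m n 1) V (1\<^sub>m 1)"
      unfolding N_def using B W V C by (intro eq_matI) auto
    then have "det C = det B * (1 + 2 * int k)"
      using N[of 1] n C V by (simp add: det_four_block_mat_upper_right_zero[of _ n _ 1])
    with det_even_symmetric[of k C] C_even n
    have "[det B * (1 + 2 * int k) = 0] (mod 4) \<or> [det B * (1 + 2 * int k) = (- 1) ^ k] (mod 4)"
      by simp
    then show ?thesis by (rule cong_cancel_sign)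
  next
    case False
    then obtain k where n: "n = 2 * k + 1" by (elim oddE)
    \<comment> \<open>\<open>N 2\<close> is the orthogonal sum of B and (1), plus the square of the
      extended covector (u, 1); this explains the corner entry 2. Its determinant carries the factor
      n + 2 = 1 + 2 (k + 1).\<close>
    have "N 2 \<in> carrier_mat (n + 1) (n + 1)"
      unfolding N_def using C B V by (intro four_block_carrier_mat) auto
    moreover have "N 2 $$ (i, j) =
        (if i < n then if j < n then C $$ (i, j) else u i else if j < n then u j else 2)"
      if "i < n + 1" "j < n + 1" for i j
      unfolding N_def BW using that C V by (simp add: V_def)
    ultimately have "even_symmetric (n + 1) (N 2)"
      using C_even by (simp add: even_symmetric_def)
    then have "even_symmetric (2 * Suc k) (N 2)"
      by (simp add: n)
    from det_even_symmetric[OF this]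
    have "[det B * (1 + 2 * int (Suc k)) = 0] (mod 4) \<or>
        [det B * (1 + 2 * int (Suc k)) = (- 1) ^ Suc k] (mod 4)"
      by (simp add: N n algebra_simps)
    then show ?thesis by (rule cong_cancel_sign)
  qed
qed

section \<open>Parity of the trace of a square\<close>

text \<open>The off-diagonal terms occur in equal pairs.\<close>

lemma even_sum_symmetric:
  fixes f :: "nat \<Rightarrow> nat \<Rightarrow> int"
  assumes "\<And>i j. f i j = f j i"
  shows "even ((\<Sum>i<n. \<Sum>j<n. f i j) - (\<Sum>i<n. f i i))"
proof (induction n)
  case (Suc n)
  have "(\<Sum>j<n. f n j) = (\<Sum>i<n. f i n)"
    by (intro sum.cong refl assms)
  then have "(\<Sum>i<Suc n. \<Sum>j<Suc n. f i j) - (\<Sum>i<Suc n. f i i) =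
      (\<Sum>i<n. \<Sum>j<n. f i j) - (\<Sum>i<n. f i i) + 2 * (\<Sum>i<n. f i n)"
    by (simp only: sum.lessThan_Suc sum.distrib)
  then show ?case using Suc.IH by (simp only: dvd_add_left_iff dvd_triv_left)
qed simp

text \<open>The products M_ij M_ji are symmetric in i and j, so modulo 2 only the diagonal squares
  survive, and each has the parity of its base.\<close>

lemma even_mat_trace_square:
  fixes M :: "int mat"
  assumes "M \<in> carrier_mat n n"
  shows "even (mat_trace (M * M) - mat_trace M)"
proof -
  have 1: "mat_trace (M * M) = (\<Sum>i<n. \<Sum>j<n. M $$ (i, j) * M $$ (j, i))"
    using assms unfolding mat_trace_def
    by (auto simp: scalar_prod_def lessThan_atLeast0 intro!: sum.cong)
  have "even ((\<Sum>i<n. \<Sum>j<n. M $$ (i, j) * M $$ (j, i)) - (\<Sum>i<n. M $$ (i, i) * M $$ (i, i)))"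
    by (rule even_sum_symmetric) (simp add: mult.commute)
  moreover have "even ((\<Sum>i<n. M $$ (i, i) * M $$ (i, i)) - mat_trace M)"
    using assms unfolding mat_trace_def by (auto simp: simp flip: sum_subtractf intro!: dvd_sum)
  ultimately show ?thesis
    unfolding 1 by (simp only: even_diff) simp
qed

section \<open>The trace form of the ring and its characteristic vector 1\<close>

context ring
begin

text \<open>Associativity of the ring enters here: left multiplication by a product is a
  composition.\<close>

lemma left_mult_mat_mult:
  assumes es: "is_Z_basis R es" and a: "a \<in> carrier R" and b: "b \<in> carrier R"
  shows "left_mult_mat R es (a \<otimes> b) = left_mult_mat R es a * left_mult_mat R es b"
proof (rule eq_matI)
  fix i j
  assume "i < dim_row (left_mult_mat R es a * left_mult_mat R es b)"
    and "j < dim_col (left_mult_mat R es a * left_mult_mat R es b)"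
  then have ij: "i < length es" "j < length es" by (auto simp: left_mult_mat_def)
  have "coords R es (a \<otimes> (b \<otimes> (es ! j))) $ i =
      (\<Sum>k<length es. coords R es (b \<otimes> (es ! j)) $ k * coords R es (a \<otimes> (es ! k)) $ i)"
    using ij a b es
    by (intro additive_basis[of "\<lambda>x. coords R es (a \<otimes> x) $ i"] es m_closed basis_nth)
      (auto simp: r_distr coords_index_add)
  then show "left_mult_mat R es (a \<otimes> b) $$ (i, j) =
      (left_mult_mat R es a * left_mult_mat R es b) $$ (i, j)"
    using ij a b es by (simp add: left_mult_mat_def scalar_prod_def lessThan_atLeast0
        m_assoc basis_nth mult.commute)
qed (auto simp: left_mult_mat_def)

lemma left_mult_mat_one:
  assumes "is_Z_basis R es"
  shows "left_mult_mat R es \<one> = 1\<^sub>m (length es)"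
  using assms by (intro eq_matI) (auto simp: left_mult_mat_def basis_nth coords_basis_nth)

text \<open>Symmetry holds even in a noncommutative ring, since Tr(MN) = Tr(NM).\<close>

lemma trace_pairing_commute:
  assumes "is_Z_basis R es" "a \<in> carrier R" "b \<in> carrier R"
  shows "trace_pairing R es a b = trace_pairing R es b a"
  using assms unfolding trace_pairing_def
  by (simp add: left_mult_mat_mult
      mat_trace_comm[OF left_mult_mat_carrier[of es a] left_mult_mat_carrier[of es b]])

lemma even_trace_pairing_self:
  assumes "is_Z_basis R es" "a \<in> carrier R"
  shows "even (trace_pairing R es a a - mat_trace (left_mult_mat R es a))"
  using assms even_mat_trace_square[OF left_mult_mat_carrier]
  unfolding trace_pairing_def by (simp add: left_mult_mat_mult)

text \<open>The characteristic vector \<open>w\<close> consists of the coordinates of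
  \<open>\<one>\<close>, and its dual covector \<open>u\<close> of the traces of the basis
  elements.\<close>

lemma det_gram_mod_4:
  assumes es: "is_Z_basis R es"
  shows "[det (gram_mat R es) = 0] (mod 4) \<or> [det (gram_mat R es) = 1] (mod 4)"
proof (rule det_characteristic_vector)
  let ?n = "length es" and ?w = "\<lambda>i. coords R es \<one> $ i"
  let ?tr = "\<lambda>a. mat_trace (left_mult_mat R es a)"
  note nth = basis_nth[OF es]
  show "gram_mat R es \<in> carrier_mat ?n ?n" by (simp add: gram_mat_def)
  show "gram_mat R es $$ (i, j) = gram_mat R es $$ (j, i)" if "i < ?n" "j < ?n" for i j
    using that by (simp add: gram_mat_def trace_pairing_commute es nth)
  show "even (gram_mat R es $$ (i, i) - ?tr (es ! i))" if "i < ?n" for i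
    using that by (simp add: gram_mat_def even_trace_pairing_self es nth del: even_diff)
  show "(\<Sum>j<?n. gram_mat R es $$ (i, j) * ?w j) = ?tr (es ! i)" if i: "i < ?n" for i
  proof -
    \<comment> \<open>The additive map sending x to Tr(e_i x) is evaluated at 1, expanded in the
      basis.\<close>
    have "?tr (es ! i \<otimes> \<one>) = (\<Sum>j<?n. ?w j * ?tr (es ! i \<otimes> es ! j))"
      using i by (intro additive_basis[of "\<lambda>x. ?tr (es ! i \<otimes> x)"] es)
        (auto simp: r_distr trace_additive es nth)
    then show ?thesis
      using i by (simp add: gram_mat_def trace_pairing_def mult.commute nth)
  qed
  have "int ?n = ?tr \<one>"
    by (simp add: left_mult_mat_one es mat_trace_def)
  also have "\<dots> = (\<Sum>i<?n. ?w i * ?tr (es ! i))"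
    by (intro additive_basis[of ?tr] es trace_additive) auto
  finally show "(\<Sum>i<?n. ?tr (es ! i) * ?w i) = int ?n"
    by (simp add: mult.commute)
qed

end

theorem theorem3p1:
  fixes A :: "('a, 'b) ring_scheme" and n :: nat
  assumes "ring_of_rank n A"
  shows "[disc A = 0] (mod 4) \<or> [disc A = 1] (mod 4)"
proof -
  obtain es where es: "is_Z_basis A es"
    using ring_of_rank_imp_basis[OF assms] by blast
  have "ring A"
    using assms by (simp add: ring_of_rank_def)
  then show ?thesis
    using ring.det_gram_mod_4[of A es] disc_eq_det_gram[of A es] es by simp
qed

end
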